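(* There is a Dirichlet series $A(s)=\sum_{n=1}^\infty a_nn^{-s}$ with $a_n\geq 0$ that is absolutely convergent for $\Re(s)>1$ and extends holomorphically to $\Re(s)\geq 1$ aside from precisely one pole of order $2$ at $s=1$, and such that $$\sum_{n\leq x}a_n=x\log x+x\Big(\tfrac12\sin\big((\log x)^2\big)-1\Big)+O(x/\log x)\qquad\text{as } x\to\infty.$$ In particular, the statement that $\sum_{n\leq x}a_n=xP_1(\log x)+o(x)$ for a linear polynomial $P_1(u)=c_1u+c_0$ is false. This example is defined by the coefficients $a_n=(\log n)\big(1+\cos((\log n)^2)\big)$. *)

theory Defs
  imports "HOL-Complex_Analysis.Complex_Analysis" "HOL-Library.Landau_Symbols"
begin

definition dirichlet_term :: "(nat \<Rightarrow> real) \<Rightarrow> complex \<Rightarrow> nat \<Rightarrow> complex" where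
  "dirichlet_term a s n = of_real (a n) * of_nat n powr (- s)"

definition dirichlet_series :: "(nat \<Rightarrow> real) \<Rightarrow> complex \<Rightarrow> complex" where
  "dirichlet_series a s = (\<Sum>\<^sub>\<infinity>n\<in>{1..}. dirichlet_term a s n)"

text \<open>
  Holomorphy on the closed half-plane means holomorphy on some open set containing it. As
  \<open>zorder\<close> is negative at poles, a pole of order \<open>k\<close> at \<open>1\<close> has \<open>zorder\<close> equal to \<open>- k\<close>.
\<close>

definition extends_to_closed_halfplane_with_pole :: "(complex \<Rightarrow> complex) \<Rightarrow> nat \<Rightarrow> bool" where
  "extends_to_closed_halfplane_with_pole A k \<longleftrightarrow>
     (\<exists>U g. open U \<and> {s. Re s \<ge> 1} \<subseteq> U \<and> g holomorphic_on (U - {1}) \<and>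
            (\<forall>s. Re s > 1 \<longrightarrow> g s = A s) \<and> is_pole g 1 \<and> zorder g 1 = - int k)"

definition summatory :: "(nat \<Rightarrow> real) \<Rightarrow> real \<Rightarrow> real" where
  "summatory a x = (\<Sum>n | 1 \<le> n \<and> real n \<le> x. a n)"

end

theory Submission
  imports Defs "HOL-Real_Asymp.Real_Asymp"
begin

text \<open>
  Write \<open>u = ln x\<close>. Comparing the sum of \<open>u (1 + cos u\<^sup>2) x\<^bsup>-s\<^esup>\<close> over the integers with its integral,
  the errors are dominated by the \<open>x\<close>-derivative, which is \<open>O((1 + \<bar>s\<bar>) x\<^bsup>-5/4\<^esup>)\<close> for \<open>Re s \<ge> 1/2\<close>, so
  they sum to a function holomorphic there. Put \<open>z = s - 1\<close>. The integral of \<open>u e\<^bsup>-zu\<^esup>\<close> over \<open>u \<ge> 0\<close> is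
  \<open>1 / z\<^sup>2\<close>, the double pole. The integral of \<open>u e\<^bsup>cu\<^sup>2-zu\<^esup>\<close> for \<open>c = \<plusminus>\<i>\<close> is entire in \<open>z\<close>: integrating by
  parts and completing the square expresses it through an entire primitive \<open>E\<close> of \<open>e\<^bsup>cw\<^sup>2\<^esup>\<close>, and
  \<open>E (u + c z / 2)\<close> tends to a constant independent of \<open>z\<close> as \<open>u\<close> grows, as long as \<open>Re z > 0\<close>.
  At \<open>s = 0\<close> the same comparison produces the oscillating main term
  \<open>x ln x + x (sin (u\<^sup>2) / 2 - 1)\<close>, which no linear polynomial in \<open>u\<close> can match: compare the points
  with \<open>u\<^sup>2 = 2 \<pi> k\<close> and \<open>u\<^sup>2 = 2 \<pi> k + \<pi> / 2\<close>.
\<close>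

section \<open>The summatory function\<close>

definition chirp_coeff :: "real \<Rightarrow> real" where
  "chirp_coeff x = ln x * (1 + cos ((ln x)\<^sup>2))"

text \<open>The last summand is a second order term: it makes the derivative of \<open>chirp_main\<close> equal
  to \<open>chirp_coeff\<close> up to \<open>O(1 / ln x)\<close>, so that the increments can be summed.\<close>
definition chirp_main :: "real \<Rightarrow> real" where
  "chirp_main x = x * ln x - x + x * sin ((ln x)\<^sup>2) / 2 + x * cos ((ln x)\<^sup>2) / (4 * ln x)"

lemma chirp_coeff_deriv:
  assumes "x > 0"
  shows "(chirp_coeff has_real_derivative
           (1 + cos ((ln x)\<^sup>2) - 2 * (ln x)\<^sup>2 * sin ((ln x)\<^sup>2)) / x) (at x)"
  unfolding chirp_coeff_def using assms
  by (auto intro!: derivative_eq_intros simp: field_simps power2_eq_square)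

text \<open>Differentiating the sine summand yields the wanted cosine term and a stray half sine,
  which the last summand cancels. What remains is a cosine times the derivative of
  \<open>x / ln x\<close>.\<close>

lemma chirp_main_deriv:
  assumes "x > 1"
  shows "(chirp_main has_real_derivative
           chirp_coeff x + cos ((ln x)\<^sup>2) / 4 * (1 / ln x - 1 / (ln x)\<^sup>2)) (at x)"
  unfolding chirp_main_def chirp_coeff_def using assms
  by (auto intro!: derivative_eq_intros)
     (auto simp: divide_simps, auto simp: algebra_simps power2_eq_square)

lemma abs_chirp_coeff_deriv_le:
  assumes "x > (0::real)"
  shows "\<bar>(1 + cos ((ln x)\<^sup>2) - 2 * (ln x)\<^sup>2 * sin ((ln x)\<^sup>2)) / x\<bar> \<le> (2 + 2 * (ln x)\<^sup>2) / x"
proof -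
  have "\<bar>2 * (ln x)\<^sup>2 * sin ((ln x)\<^sup>2)\<bar> \<le> 2 * (ln x)\<^sup>2"
    using mult_left_mono[OF abs_sin_le_one[of "(ln x)\<^sup>2"], of "2 * (ln x)\<^sup>2"] by (simp add: abs_mult)
  moreover have "\<bar>1 + cos ((ln x)\<^sup>2)\<bar> \<le> 2"
    using abs_cos_le_one[of "(ln x)\<^sup>2"] by linarith
  ultimately have "\<bar>1 + cos ((ln x)\<^sup>2) - 2 * (ln x)\<^sup>2 * sin ((ln x)\<^sup>2)\<bar> \<le> 2 + 2 * (ln x)\<^sup>2"
    by linarith
  then show ?thesis
    using assms by (simp add: abs_div divide_right_mono)
qed

section \<open>Growth of \<open>x / ln x\<close>, the gauge for the error term\<close>

lemma x_div_ln_deriv: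
  assumes "x > (1::real)"
  shows "((\<lambda>x. x / ln x) has_real_derivative 1 / ln x - 1 / (ln x)\<^sup>2) (at x)"
  using assms by (auto intro!: derivative_eq_intros simp: divide_simps power2_eq_square)

text \<open>From \<open>ln x = 2\<close> on, the square term takes away at most half of
  \<open>1 / ln x\<close>, so the derivative of \<open>x / ln x\<close> is positive and of order
  \<open>1 / ln x\<close>.\<close>

lemma ln_ge_two_imp:
  assumes "ln x \<ge> (2::real)" "x > 0"
  shows "1 / ln x - 1 / (ln x)\<^sup>2 \<ge> 1 / (2 * ln x)" "x > 1"
proof -
  show "x > 1" using assms by (metis less_le_trans ln_gt_zero_iff zero_less_numeral)
  show "1 / ln x - 1 / (ln x)\<^sup>2 \<ge> 1 / (2 * ln x)"
    using assms(1) by (simp add: field_simps power2_eq_square)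
qed

text \<open>This lets errors of size \<open>1 / ln n\<close> be summed by telescoping: each is at
  most a constant times an increment of \<open>x / ln x\<close>.\<close>

lemma x_div_ln_increment_ge:
  assumes "ln x \<ge> (2::real)" "x > 0"
  shows "1 / (4 * ln x) \<le> (x + 1) / ln (x + 1) - x / ln x"
proof -
  have x: "x > 1" using ln_ge_two_imp assms by blast
  have "\<exists>t. t > x \<and> t < x + 1 \<and> (x + 1) / ln (x + 1) - x / ln x = (x + 1 - x) * (1 / ln t - 1 / (ln t)\<^sup>2)"
    using x by (intro MVT2 x_div_ln_deriv) auto
  then obtain t where t: "t > x" "t < x + 1"
    "(x + 1) / ln (x + 1) - x / ln x = 1 / ln t - 1 / (ln t)\<^sup>2" by auto
  have "ln t \<ge> ln x" using t x by simp
  \<comment> \<open>This gives \<open>ln t \<le> 2 * ln x\<close>, so moving the bound from the mean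
    value point \<open>t\<close> back to \<open>x\<close> costs a factor 2.\<close>
  have "x + 1 \<le> x ^ 2" 
  proof -
    have "x \<ge> 2" using assms ln_le_minus_one[of x] by linarith
    then have "2 * x \<le> x * x" by simp
    then show ?thesis using \<open>x \<ge> 2\<close> unfolding power2_eq_square by linarith
  qed
  then have "ln t \<le> ln (x ^ 2)" using t x by simp
  then have "ln t \<le> 2 * ln x" using x by (simp add: ln_realpow)
  then have "1 / (4 * ln x) \<le> 1 / (2 * ln t)"
    using \<open>ln t \<ge> ln x\<close> assms by (intro frac_le) linarith+
  then show ?thesis using ln_ge_two_imp(1)[of t] t x \<open>ln t \<ge> ln x\<close> assms by linarith
qed

lemma x_div_ln_mono:
  assumes "ln x \<ge> (2::real)" "x > 0" "x \<le> y"
  shows "x / ln x \<le> y / ln y"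
proof (rule DERIV_nonneg_imp_nondecreasing[OF assms(3)])
  fix t assume t: "x \<le> t" "t \<le> y"
  then have l: "ln t \<ge> 2" using assms ln_mono[of x t] by linarith
  have "t > 0" using t assms by linarith
  note t2 = ln_ge_two_imp[OF l this]
  have "0 \<le> 1 / (2 * ln t)" using l by simp
  then have "0 \<le> 1 / ln t - 1 / (ln t)\<^sup>2" using t2 by linarith
  then show "\<exists>d. ((\<lambda>x. x / ln x) has_real_derivative d) (at t) \<and> 0 \<le> d"
    using x_div_ln_deriv[OF t2(2)] by blast
qed

text \<open>Two applications of the mean value theorem: one turns the increment into a derivative at
  \<open>t\<close>, the other moves \<open>chirp_coeff\<close> from \<open>t\<close> to
  \<open>n\<close>. The moved coefficient and the remainder of the derivative each contribute at
  most \<open>1 / ln n\<close>.\<close>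

lemma chirp_main_increment:
  assumes "ln n \<ge> (2::real)" "n > 0" 
    and small: "\<And>t. t \<ge> n \<Longrightarrow> (2 + 2 * (ln t)\<^sup>2) / t \<le> 1 / ln t"
  shows "\<bar>chirp_main (n + 1) - chirp_main n - chirp_coeff n\<bar> \<le> 2 / ln n"
proof -
  have n: "n > 1" using ln_ge_two_imp assms by blast
  have "\<exists>t. t > n \<and> t < n + 1 \<and> chirp_main (n + 1) - chirp_main n =
      (n + 1 - n) * (chirp_coeff t + cos ((ln t)\<^sup>2) / 4 * (1 / ln t - 1 / (ln t)\<^sup>2))"
    using n by (intro MVT2 chirp_main_deriv) auto
  then obtain t where t: "t > n" "t < n + 1" "chirp_main (n + 1) - chirp_main n =
      chirp_coeff t + cos ((ln t)\<^sup>2) / 4 * (1 / ln t - 1 / (ln t)\<^sup>2)" by auto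
  have "\<exists>r. r > n \<and> r < t \<and> chirp_coeff t - chirp_coeff n =
      (t - n) * ((1 + cos ((ln r)\<^sup>2) - 2 * (ln r)\<^sup>2 * sin ((ln r)\<^sup>2)) / r)"
    using n t by (intro MVT2 chirp_coeff_deriv) auto
  then obtain r where r: "r > n" "r < t" "chirp_coeff t - chirp_coeff n =
      (t - n) * ((1 + cos ((ln r)\<^sup>2) - 2 * (ln r)\<^sup>2 * sin ((ln r)\<^sup>2)) / r)" by auto
  have lt: "ln t \<ge> ln n" "ln r \<ge> ln n" using t r n by auto
  have "\<bar>chirp_coeff t - chirp_coeff n\<bar> \<le> 1 * (1 / ln r)"
    unfolding r(3) abs_mult using t r n small[of r] abs_chirp_coeff_deriv_le[of r]
    by (intro mult_mono) auto
  also have "\<dots> \<le> 1 / ln n" using frac_le[of 1 1 "ln n" "ln r"] lt assms(1) by simp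
  finally have A: "\<bar>chirp_coeff t - chirp_coeff n\<bar> \<le> 1 / ln n" .
  have "0 \<le> 1 / (2 * ln t)" using lt assms by simp
  then have "0 \<le> 1 / ln t - 1 / (ln t)\<^sup>2"
    using ln_ge_two_imp(1)[of t] lt t n assms by linarith
  moreover have "1 / ln t - 1 / (ln t)\<^sup>2 \<le> 1 / ln n"
    using frac_le[of 1 1 "ln n" "ln t"] lt assms zero_le_power2[of "ln t"]
    by (smt (verit) divide_nonneg_nonneg)
  ultimately have "\<bar>cos ((ln t)\<^sup>2) / 4 * (1 / ln t - 1 / (ln t)\<^sup>2)\<bar> \<le> 1 * (1 / ln n)"
    unfolding abs_mult using abs_cos_le_one[of "(ln t)\<^sup>2"] by (intro mult_mono) linarith+
  then show ?thesis using A t(3) by linarith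
qed

lemma abs_chirp_coeff_le:
  assumes "x \<ge> 1"
  shows "\<bar>chirp_coeff x\<bar> \<le> 2 * ln x"
proof -
  have "\<bar>1 + cos ((ln x)\<^sup>2)\<bar> \<le> 2" using abs_cos_le_one[of "(ln x)\<^sup>2"] by linarith
  from mult_left_mono[OF this, of "ln x"] show ?thesis
    using assms by (simp add: chirp_coeff_def abs_mult mult.commute)
qed

text \<open>Used to pass from the integer part of \<open>x\<close> to \<open>x\<close> itself. A
  crude logarithmic bound is enough, since \<open>ln x\<close> is
  \<open>O(x / ln x)\<close>.\<close>

lemma chirp_main_short_increment:
  assumes "ln n \<ge> (2::real)" "n > 0" "n \<le> x" "x \<le> n + 1"
  shows "\<bar>chirp_main x - chirp_main n\<bar> \<le> 2 * ln x + 1"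
proof (cases "x = n")
  case True
  then show ?thesis using assms by simp
next
  case False
  have n: "n > 1" using ln_ge_two_imp assms by blast
  have "\<exists>t. t > n \<and> t < x \<and> chirp_main x - chirp_main n =
      (x - n) * (chirp_coeff t + cos ((ln t)\<^sup>2) / 4 * (1 / ln t - 1 / (ln t)\<^sup>2))"
    using n False assms by (intro MVT2 chirp_main_deriv) auto
  then obtain t where t: "t > n" "t < x" "chirp_main x - chirp_main n =
      (x - n) * (chirp_coeff t + cos ((ln t)\<^sup>2) / 4 * (1 / ln t - 1 / (ln t)\<^sup>2))" by auto
  have lt: "ln t \<ge> ln n" "ln t \<le> ln x" using t n by auto
  have "0 \<le> 1 / (2 * ln t)" using lt assms by simp
  then have "0 \<le> 1 / ln t - 1 / (ln t)\<^sup>2"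
    using ln_ge_two_imp(1)[of t] lt t n assms by linarith
  moreover have "1 / ln t - 1 / (ln t)\<^sup>2 \<le> 1"
    using lt assms zero_le_power2[of "ln t"] divide_le_eq_1_pos[of "ln t" 1]
    by (smt (verit) divide_nonneg_nonneg)
  ultimately have "\<bar>cos ((ln t)\<^sup>2) / 4 * (1 / ln t - 1 / (ln t)\<^sup>2)\<bar> \<le> 1 * 1"
    unfolding abs_mult using abs_cos_le_one[of "(ln t)\<^sup>2"] by (intro mult_mono) linarith+
  moreover have "\<bar>chirp_coeff t\<bar> \<le> 2 * ln x" using abs_chirp_coeff_le[of t] t n lt by linarith
  ultimately have "\<bar>chirp_coeff t + cos ((ln t)\<^sup>2) / 4 * (1 / ln t - 1 / (ln t)\<^sup>2)\<bar> \<le> 2 * ln x + 1"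
    by linarith
  then have "\<bar>chirp_main x - chirp_main n\<bar> \<le> 1 * (2 * ln x + 1)"
    unfolding t(3) abs_mult using assms t by (intro mult_mono) auto
  then show ?thesis by simp
qed

lemma summatory_eq_sum_floor:
  assumes "x \<ge> 0"
  shows "summatory a x = (\<Sum>n\<in>{1..nat \<lfloor>x\<rfloor>}. a n)"
proof -
  have "{n::nat. 1 \<le> n \<and> real n \<le> x} = {1..nat \<lfloor>x\<rfloor>}"
    using assms by (auto simp: le_nat_floor) linarith
  then show ?thesis by (simp add: summatory_def)
qed

lemma summatory_chirp_coeff:
  "(\<lambda>x. summatory (\<lambda>n. chirp_coeff (real n)) x
        - (x * ln x + x * (1 / 2 * sin ((ln x)\<^sup>2) - 1))) \<in> O(\<lambda>x. x / ln x)"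
proof -
  define S where "S N = (\<Sum>n\<in>{1..N}. chirp_coeff (real n))" for N
  have "eventually (\<lambda>t::real. ln t \<ge> 2 \<and> t > 0 \<and> (2 + 2 * (ln t)\<^sup>2) / t \<le> 1 / ln t) at_top"
    by (intro eventually_conj; real_asymp)
  then obtain X :: real where X: "\<And>t. t \<ge> X \<Longrightarrow> ln t \<ge> 2 \<and> t > 0 \<and> (2 + 2 * (ln t)\<^sup>2) / t \<le> 1 / ln t"
    by (metis (mono_tags, lifting) eventually_at_top_linorder)
  define M where "M = nat \<lceil>X\<rceil> + 1"
  have M: "real N \<ge> X" if "N \<ge> M" for N using that unfolding M_def by linarith
  define D :: "real \<Rightarrow> real" where "D x = x / ln x" for x
  define K where "K = \<bar>S M - chirp_coeff M - chirp_main M\<bar>"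
  \<comment> \<open>Removing the last coefficient leaves the sum over \<open>n < N\<close>, so that
    going from \<open>n\<close> to \<open>n + 1\<close> adds \<open>chirp_coeff n\<close>, the left
    end value in \<open>chirp_main_increment\<close>. The factor 8 converts \<open>2 / ln n\<close>
    into increments of \<open>D\<close>.\<close>
  have *: "\<bar>S N - chirp_coeff N - chirp_main N\<bar> \<le> K + 8 * (D N - D M)" if "N \<ge> M" for N :: nat
    using that
  proof (induction N rule: dec_induct)
    case base
    then show ?case by (simp add: K_def)
  next
    case (step n)
    have n: "real n \<ge> X" using M step by auto
    have small: "(2 + 2 * (ln t)\<^sup>2) / t \<le> 1 / ln t" if "t \<ge> real n" for t
      using X[of t] n that by linarith
    have "\<bar>chirp_main (real n + 1) - chirp_main n - chirp_coeff n\<bar> \<le> 2 / ln n"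
      using X[OF n] small by (intro chirp_main_increment) auto
    also have "2 / ln n = 8 * (1 / (4 * ln n))" by simp
    also have "\<dots> \<le> 8 * (D (real n + 1) - D n)"
      unfolding D_def using X[OF n] by (intro mult_left_mono x_div_ln_increment_ge) auto
    finally have inc: "\<bar>chirp_main (real n + 1) - chirp_main n - chirp_coeff n\<bar>
      \<le> 8 * (D (real n + 1) - D n)" .
    have "S (Suc n) - chirp_coeff (Suc n) - chirp_main (Suc n) = (S n - chirp_coeff n - chirp_main n)
        - (chirp_main (real n + 1) - chirp_main n - chirp_coeff n)"
      by (simp add: S_def add.commute)
    also have "\<bar>\<dots>\<bar> \<le> (K + 8 * (D n - D M)) + 8 * (D (real n + 1) - D n)"
      by (intro order_trans[OF abs_triangle_ineq4] add_mono step.IH inc)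
    also have "\<dots> = K + 8 * (D (Suc n) - D M)" by (simp add: add.commute)
    finally show ?case .
  qed
  \<comment> \<open>Half of \<open>4 * ln x\<close> comes from restoring the coefficient at
    \<open>N\<close>, the other half and the 1 from the step between \<open>N\<close> and
    \<open>x\<close>.\<close>
  have "\<bar>summatory (\<lambda>n. chirp_coeff (real n)) x - chirp_main x\<bar> \<le> (K + 4 * ln x + 1) + 8 * D x"
    if "x \<ge> M" for x :: real
  proof -
    define N where "N = nat \<lfloor>x\<rfloor>"
    have x0: "x \<ge> 0" using that by linarith
    have N: "N \<ge> M" "real N \<le> x" "x \<le> real N + 1" using that x0 unfolding N_def by linarith+
    have lN: "ln N \<ge> 2" "real N > 0" using X[OF M[OF N(1)]] by auto
    have "\<bar>chirp_main x - chirp_main N\<bar> \<le> 2 * ln x + 1"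
      using lN N by (intro chirp_main_short_increment)
    moreover have "\<bar>chirp_coeff N\<bar> \<le> 2 * ln x"
      by (rule order_trans[OF abs_chirp_coeff_le]) (use lN N in auto)
    moreover have "D N \<le> D x" unfolding D_def using lN N by (intro x_div_ln_mono)
    moreover have "D M \<ge> 0"
      unfolding D_def using X[of M] M[of M] by (intro divide_nonneg_nonneg) auto
    moreover have "summatory (\<lambda>n. chirp_coeff (real n)) x = S N"
      unfolding S_def N_def using x0 by (rule summatory_eq_sum_floor)
    ultimately show ?thesis using *[OF N(1)] by argo
  qed
  then have "eventually (\<lambda>x. norm (summatory (\<lambda>n. chirp_coeff (real n)) x - chirp_main x)
       \<le> 1 * norm ((K + 4 * ln x + 1) + 8 * D x)) at_top"
    unfolding eventually_at_top_linorder real_norm_def by (intro exI[of _ "real M"]) fastforce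
  then have "(\<lambda>x. summatory (\<lambda>n. chirp_coeff (real n)) x - chirp_main x)
       \<in> O(\<lambda>x. (K + 4 * ln x + 1) + 8 * D x)" by (rule bigoI)
  also have "(\<lambda>x. (K + 4 * ln x + 1) + 8 * D x) \<in> O(\<lambda>x. x / ln x)" unfolding D_def by real_asymp
  finally have 1: "(\<lambda>x. summatory (\<lambda>n. chirp_coeff (real n)) x - chirp_main x) \<in> O(\<lambda>x. x / ln x)" .
  have 2: "(\<lambda>x::real. x * cos ((ln x)\<^sup>2) / (4 * ln x)) \<in> O(\<lambda>x. x / ln x)"
  proof (rule bigoI[where c = 1], rule always_eventually, rule allI)
    fix x :: real
    have "\<bar>x / ln x * (cos ((ln x)\<^sup>2) / 4)\<bar> \<le> \<bar>x / ln x\<bar> * 1"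
      unfolding abs_mult using abs_cos_le_one[of "(ln x)\<^sup>2"] by (intro mult_left_mono) (linarith, simp)
    then show "norm (x * cos ((ln x)\<^sup>2) / (4 * ln x)) \<le> 1 * norm (x / ln x)" by simp
  qed
  show ?thesis using sum_in_bigo(1)[OF 1 2]
    by (simp add: chirp_main_def algebra_simps)
qed

section \<open>Failure of every linear main term\<close>

lemma no_linear_main_term:
  fixes c\<^sub>1 c\<^sub>0 :: real
  assumes A: "(\<lambda>x. F x - (x * ln x + x * (1 / 2 * sin ((ln x)\<^sup>2) - 1))) \<in> O(\<lambda>x. x / ln x)"
    and B: "(\<lambda>x. F x - x * (c\<^sub>1 * ln x + c\<^sub>0)) \<in> o(\<lambda>x. x)"
  shows False
proof -
  have "(\<lambda>x::real. x / ln x) \<in> o(\<lambda>x. x)" by real_asymp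
  with A have "(\<lambda>x. F x - (x * ln x + x * (1 / 2 * sin ((ln x)\<^sup>2) - 1))) \<in> o(\<lambda>x. x)"
    by (rule landau_o.big_small_trans)
  from sum_in_smallo(2)[OF B this]
  have "(\<lambda>x. x * ((1 - c\<^sub>1) * ln x + sin ((ln x)\<^sup>2) / 2 - 1 - c\<^sub>0)) \<in> o(\<lambda>x. x)"
    by (simp add: algebra_simps)
  then have "((\<lambda>x. x * ((1 - c\<^sub>1) * ln x + sin ((ln x)\<^sup>2) / 2 - 1 - c\<^sub>0) / x) \<longlongrightarrow> 0) at_top"
    by (rule smalloD_tendsto)
  moreover have "eventually (\<lambda>x::real. x * ((1 - c\<^sub>1) * ln x + sin ((ln x)\<^sup>2) / 2 - 1 - c\<^sub>0) / x
      = (1 - c\<^sub>1) * ln x + sin ((ln x)\<^sup>2) / 2 - 1 - c\<^sub>0) at_top"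
    using eventually_gt_at_top[of 0] by eventually_elim simp
  ultimately have lim: "((\<lambda>x. (1 - c\<^sub>1) * ln x + sin ((ln x)\<^sup>2) / 2 - 1 - c\<^sub>0) \<longlongrightarrow> 0) at_top"
    using tendsto_cong by force
  \<comment> \<open>Sampling at \<open>x = exp (sqrt (t + 2 * pi * k))\<close> freezes the
    oscillating term at \<open>sin t\<close>.\<close>
  have along: "(\<lambda>k::nat. (1 - c\<^sub>1) * sqrt (t + 2 * pi * k) + sin t / 2 - 1 - c\<^sub>0) \<longlonglongrightarrow> 0"
    if "t \<ge> 0" for t
  proof -
    have "filterlim (\<lambda>k::nat. exp (sqrt (t + 2 * pi * k))) at_top sequentially"
      using pi_gt_zero by real_asymp
    from filterlim_compose[OF lim this] show ?thesis
      using that sin.plus_of_nat[of t] by (simp add: mult_ac)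
  qed
  \<comment> \<open>Dividing by the growing square root isolates the leading coefficient.\<close>
  have "(\<lambda>k::nat. ((1 - c\<^sub>1) * sqrt (0 + 2 * pi * k) + sin 0 / 2 - 1 - c\<^sub>0) / sqrt (0 + 2 * pi * k)) \<longlonglongrightarrow> 0"
    by (rule real_tendsto_divide_at_top[OF along]) (use pi_gt_zero in \<open>simp, real_asymp\<close>)+
  moreover have "(\<lambda>k::nat. ((1 - c\<^sub>1) * sqrt (0 + 2 * pi * k) + sin 0 / 2 - 1 - c\<^sub>0) / sqrt (0 + 2 * pi * k)) \<longlonglongrightarrow> 1 - c\<^sub>1"
    using pi_gt_zero by real_asymp
  ultimately have c1: "c\<^sub>1 = 1" using LIMSEQ_unique by force
  \<comment> \<open>With the leading coefficient gone the sampled sequences are constant, and the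
    phases 0 and \<open>pi / 2\<close> demand different constant terms.\<close>
  have "- 1 - c\<^sub>0 = 0" using along[of 0] c1 by (simp add: LIMSEQ_const_iff)
  moreover have "1 / 2 - 1 - c\<^sub>0 = 0" using along[of "pi / 2"] c1 by (simp add: LIMSEQ_const_iff)
  ultimately show False by simp
qed

section \<open>Comparison of sum and integral\<close>

text \<open>At \<open>u = ln n\<close> the factor \<open>exp (- s * u)\<close> is the power of
  \<open>n\<close> in a Dirichlet term. The values 0, \<open>\<i>\<close> and \<open>- \<i>\<close>
  of \<open>c\<close> give the constant part of the coefficient and the two exponentials of the
  cosine.\<close>

definition chirp :: "complex \<Rightarrow> complex \<Rightarrow> complex \<Rightarrow> complex" where
  "chirp c s u = u * exp (c * u\<^sup>2 - s * u)"

lemma norm_exp_chirp: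
  fixes c s :: complex and u :: real
  assumes "Re c = 0"
  shows "norm (exp (c * (of_real u)\<^sup>2 - s * of_real u)) = exp (- Re s * u)"
proof -
  have "Re (c * (of_real u)\<^sup>2) = 0"
    using assms by (simp flip: of_real_power)
  then show ?thesis by simp
qed

lemma chirp_ln_vector_derivative:
  assumes "x > 0"
  shows "((\<lambda>x. chirp c s (of_real (ln x))) has_vector_derivative
     of_real (1 / x) * (exp (c * (of_real (ln x))\<^sup>2 - s * of_real (ln x)) *
        (1 + 2 * c * (of_real (ln x))\<^sup>2 - s * of_real (ln x)))) (at x)"
proof -
  have "(chirp c s has_field_derivative exp (c * u\<^sup>2 - s * u) * (1 + 2 * c * u\<^sup>2 - s * u)) (at u)" for u
    unfolding chirp_def
    by (auto intro!: derivative_eq_intros simp: algebra_simps power2_eq_square)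
  moreover have "((\<lambda>x. complex_of_real (ln x)) has_vector_derivative of_real (1 / x)) (at x)"
    using assms by (intro has_vector_derivative_of_real)
      (auto intro!: derivative_eq_intros simp flip: has_real_derivative_iff_has_vector_derivative)
  ultimately show ?thesis
    using field_vector_diff_chain_at[of "\<lambda>x. complex_of_real (ln x)" "of_real (1 / x)" x "chirp c s"]
    by (auto simp: o_def)
qed

lemma ln_le_powr_eighth:
  assumes "x \<ge> (1::real)"
  shows "ln x \<le> 8 * x powr (1 / 8)"
  using ln_powr_bound[of x "1/8"] assms by simp

text \<open>The exponent is \<open>- 1\<close> from the chain rule, \<open>- 1/2\<close> from
  \<open>Re s\<close> and \<open>1/4\<close> for the logarithms. By \<open>ln_le_powr_eighth\<close>
  the squared logarithm is at most 64 times the latter, so 1 + 2 * 64 fits under 130.\<close>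

lemma chirp_ln_derivative_bound:
  assumes "Re c = 0" "norm c \<le> 1" "Re s \<ge> 1 / 2" "x \<ge> (1::real)"
  shows "norm (of_real (1 / x) * (exp (c * (of_real (ln x))\<^sup>2 - s * of_real (ln x)) *
        (1 + 2 * c * (of_real (ln x))\<^sup>2 - s * of_real (ln x)))) \<le> 130 * (1 + norm s) * x powr (- 5 / 4)"
proof -
  have l: "ln x \<ge> 0" using assms by simp
  have p: "x powr (1/8) \<le> x powr (1/4)" "1 \<le> x powr (1/4)"
    using assms by (auto intro!: powr_mono ge_one_powr_ge_zero)
  have "(ln x)\<^sup>2 \<le> (8 * x powr (1/8))\<^sup>2"
    using ln_le_powr_eighth[OF assms(4)] l by (intro power_mono)
  also have "\<dots> = 64 * x powr (1/4)"
    by (simp add: power_mult_distrib power2_eq_square flip: powr_add)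
  finally have l2: "(ln x)\<^sup>2 \<le> 64 * x powr (1/4)" .
  have l1: "ln x \<le> 8 * x powr (1/4)" using ln_le_powr_eighth[OF assms(4)] p by linarith
  have "norm (1 + 2 * c * (of_real (ln x))\<^sup>2 - s * of_real (ln x))
      \<le> norm (1::complex) + norm (2 * c * (of_real (ln x))\<^sup>2) + norm (s * of_real (ln x))"
    by (rule order_trans[OF norm_triangle_ineq4 add_right_mono[OF norm_triangle_ineq]])
  also have "norm (1::complex) + norm (2 * c * (of_real (ln x))\<^sup>2) + norm (s * of_real (ln x))
      = 1 + 2 * (norm c * (ln x)\<^sup>2) + norm s * ln x"
    using l by (simp add: norm_mult norm_power)
  also have "\<dots> \<le> x powr (1/4) + 2 * (1 * (64 * x powr (1/4))) + norm s * (8 * x powr (1/4))"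
    using p l1 l2 assms l by (intro add_mono mult_mono mult_left_mono) auto
  also have "\<dots> \<le> 130 * (1 + norm s) * x powr (1/4)"
    using p by (simp add: algebra_simps)
  finally have A: "norm (1 + 2 * c * (of_real (ln x))\<^sup>2 - s * of_real (ln x)) \<le> 130 * (1 + norm s) * x powr (1/4)" .
  have B: "norm (exp (c * (of_real (ln x))\<^sup>2 - s * of_real (ln x))) \<le> x powr (- 1/2)"
    unfolding norm_exp_chirp[OF assms(1)] using mult_right_mono[OF assms(3) l] assms by (simp add: powr_def)
  have C: "norm (complex_of_real (1 / x)) = x powr (-1)"
    using assms by (simp add: powr_minus_divide norm_divide)
  have "norm (of_real (1 / x) * (exp (c * (of_real (ln x))\<^sup>2 - s * of_real (ln x)) *
        (1 + 2 * c * (of_real (ln x))\<^sup>2 - s * of_real (ln x))))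
     \<le> x powr (-1) * (x powr (- 1/2) * (130 * (1 + norm s) * x powr (1/4)))"
    unfolding norm_mult[of _ "_ * _"] norm_mult[of "exp _"] C using A B by (intro mult_left_mono mult_mono) auto
  also have "\<dots> = 130 * (1 + norm s) * (x powr (-1) * x powr (- 1/2) * x powr (1/4))"
    by simp
  also have "x powr (-1) * x powr (- 1/2) * x powr (1/4) = x powr (-5/4)"
    by (simp only: powr_add[symmetric]) simp
  finally show ?thesis .
qed

text \<open>If \<open>\<Psi> z\<close> is a primitive of \<open>chirp c z\<close>, then \<open>\<Psi> (s - 1) (ln x)\<close> is a primitive of
  \<open>chirp c s (ln x)\<close> in \<open>x\<close>: the shift of \<open>s\<close> absorbs the factor \<open>1 / x\<close>. The term at \<open>n\<close> belongs
  to the integer \<open>n + 1\<close>.\<close>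
definition em_defect :: "complex \<Rightarrow> (complex \<Rightarrow> complex \<Rightarrow> complex) \<Rightarrow> nat \<Rightarrow> complex \<Rightarrow> complex" where
  "em_defect c \<Psi> n s = chirp c s (of_real (ln (Suc n)))
     - (\<Psi> (s - 1) (of_real (ln (Suc (Suc n)))) - \<Psi> (s - 1) (of_real (ln (Suc n))))"

lemma em_defect_bound:
  assumes c: "Re c = 0" "norm c \<le> 1" and s: "Re s \<ge> 1 / 2"
    and \<Psi>: "\<And>u. (\<Psi> (s - 1) has_field_derivative chirp c (s - 1) u) (at u)"
  shows "norm (em_defect c \<Psi> n s) \<le> 130 * (1 + norm s) * real (Suc n) powr (- 5 / 4)"
proof -
  define a where "a = real (Suc n)"
  have a: "a \<ge> 1" by (simp add: a_def)
  let ?B = "130 * (1 + norm s) * a powr (- 5 / 4)"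
  have chirp_bound: "norm (chirp c s (of_real (ln x)) - chirp c s (of_real (ln a))) \<le> ?B"
    if x: "x \<in> {a..a+1}" for x
  proof -
    have "norm (chirp c s (of_real (ln x)) - chirp c s (of_real (ln a))) \<le> ?B * norm (x - a)"
    proof (rule differentiable_bound[of "{a..a+1}"])
      fix t assume t: "t \<in> {a..a+1}"
      then have t1: "t \<ge> 1" using a by auto
      show "((\<lambda>x. chirp c s (of_real (ln x))) has_derivative (\<lambda>h. h *\<^sub>R (of_real (1 / t) * (exp (c * (of_real (ln t))\<^sup>2 - s * of_real (ln t)) *
        (1 + 2 * c * (of_real (ln t))\<^sup>2 - s * of_real (ln t)))))) (at t within {a..a+1})"
        using chirp_ln_vector_derivative[of t c s] t1
        by (auto simp: has_vector_derivative_def intro: has_derivative_at_withinI)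
      \<comment> \<open>The power decreases, so the bound at the left end covers the whole
        interval.\<close>
      have "130 * (1 + norm s) * t powr (- 5 / 4) \<le> ?B"
        using a t by (intro mult_left_mono powr_mono2') auto
      then have B: "norm (of_real (1 / t) * (exp (c * (of_real (ln t))\<^sup>2 - s * of_real (ln t)) *
        (1 + 2 * c * (of_real (ln t))\<^sup>2 - s * of_real (ln t)))) \<le> ?B"
        using chirp_ln_derivative_bound[OF c s t1] by (rule order_trans[rotated])
      show "onorm (\<lambda>h. h *\<^sub>R (of_real (1 / t) * (exp (c * (of_real (ln t))\<^sup>2 - s * of_real (ln t)) *
        (1 + 2 * c * (of_real (ln t))\<^sup>2 - s * of_real (ln t))))) \<le> ?B"
        unfolding norm_scaleR
        by (intro onorm_le) (use mult_right_mono[OF B] in \<open>simp only: norm_scaleR mult.commute real_norm_def abs_ge_zero\<close>)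
    qed (use x a in auto)
    also have "\<dots> \<le> ?B * 1" using x by (intro mult_left_mono) auto
    finally show ?thesis by simp
  qed
  have dPsi: "((\<lambda>x. \<Psi> (s - 1) (of_real (ln x))) has_vector_derivative chirp c s (of_real (ln x))) (at x)"
    if "x > 0" for x
  proof -
    have "((\<lambda>x. complex_of_real (ln x)) has_vector_derivative of_real (1 / x)) (at x)"
      using that by (intro has_vector_derivative_of_real)
        (auto intro!: derivative_eq_intros simp flip: has_real_derivative_iff_has_vector_derivative)
    then have "(\<Psi> (s - 1) \<circ> (\<lambda>x. of_real (ln x)) has_vector_derivative
        of_real (1 / x) * chirp c (s - 1) (of_real (ln x))) (at x)"
      by (rule field_vector_diff_chain_at) (rule \<Psi>)
    moreover have "of_real (1 / x) * chirp c (s - 1) (of_real (ln x)) = chirp c s (of_real (ln x))"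
    proof -
      have "exp (c * (of_real (ln x))\<^sup>2 - (s - 1) * of_real (ln x))
          = of_real x * exp (c * (of_real (ln x))\<^sup>2 - s * of_real (ln x))"
        using that by (simp add: exp_diff exp_of_real left_diff_distrib)
      then show ?thesis using that by (simp add: chirp_def)
    qed
    ultimately show ?thesis by (simp add: o_def)
  qed
  \<comment> \<open>The derivative of the primitive strays from its left end value by at most
    \<open>?B\<close>, hence so does its increment over an interval of length 1.\<close>
  have "norm (\<Psi> (s - 1) (of_real (ln (a + 1))) - \<Psi> (s - 1) (of_real (ln a)) - (a + 1 - a) *\<^sub>R chirp c s (of_real (ln a)))
     \<le> norm (a + 1 - a) * ?B"
  proof (rule vector_differentiable_bound_linearization[where S = "{a..a+1}"
        and f' = "\<lambda>x. chirp c s (of_real (ln x))"])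
    show "((\<lambda>x. \<Psi> (s - 1) (of_real (ln x))) has_vector_derivative chirp c s (of_real (ln x)))
        (at x within {a..a+1})" if "x \<in> {a..a+1}" for x
      using that a by (intro has_vector_derivative_at_within[OF dPsi]) auto
    show "closed_segment a (a + 1) \<subseteq> {a..a + 1}" by (simp add: closed_segment_eq_real_ivl)
  qed (fact chirp_bound, simp)
  then show ?thesis
    by (simp add: em_defect_def a_def norm_minus_commute add.commute)
qed

text \<open>The point 1 is left out of \<open>D\<close> because the primitive for
  \<open>c = 0\<close> is singular there. The defect bounds do not see that singularity, so the sum
  stays bounded near 1 and extends by Riemann's theorem on removable singularities.\<close>

lemma em_series:
  assumes c: "Re c = 0" "norm c \<le> 1"
    and \<Psi>: "\<And>s u. s \<in> D \<Longrightarrow> (\<Psi> (s - 1) has_field_derivative chirp c (s - 1) u) (at u)"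
    and hol: "\<And>u. (\<lambda>s. \<Psi> (s - 1) u) holomorphic_on D"
    and D: "D = {s. Re s > 1 / 2} - {1}"
  obtains R where "R holomorphic_on {s. Re s > 1 / 2}" "\<And>s. s \<in> D \<Longrightarrow> (\<lambda>n. em_defect c \<Psi> n s) sums R s"
proof -
  let ?b = "\<lambda>n. real (Suc n) powr (- 5 / 4)"
  have sb: "summable ?b"
    using summable_Suc_iff[of "\<lambda>n. real n powr (-5/4)"] summable_real_powr_iff[of "-5/4"] by simp
  have bnd: "norm (em_defect c \<Psi> n s) \<le> 130 * (1 + norm s) * ?b n" if "s \<in> D" for s n
    using that D by (intro em_defect_bound c \<Psi>) auto
  define R where "R s = (\<Sum>n. em_defect c \<Psi> n s)" for s
  have summ: "summable (\<lambda>n. em_defect c \<Psi> n s)" if "s \<in> D" for s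
    using bnd[OF that] by (intro summable_comparison_test'[OF summable_mult[OF sb]])
  have Rb: "norm (R s) \<le> 130 * (1 + norm s) * (\<Sum>n. ?b n)" if "s \<in> D" for s
    unfolding R_def suminf_mult[OF sb, symmetric]
    by (rule norm_suminf_le[OF bnd[OF that] summable_mult[OF sb]])
  have oD: "open D" unfolding D by (intro open_Diff open_halfspace_Re_gt) auto
  have "R holomorphic_on D"
  \<comment> \<open>The defect bound depends on \<open>s\<close> only through \<open>norm s\<close>,
    so the Weierstrass test applies on closed discs.\<close>
  proof (rule holomorphic_uniform_sequence[OF oD])
    show "(\<lambda>s. \<Sum>n<N. em_defect c \<Psi> n s) holomorphic_on D" for N
      unfolding em_defect_def chirp_def by (intro holomorphic_intros hol)
    fix s assume "s \<in> D"
    then obtain d where d: "d > 0" "cball s d \<subseteq> D" using oD open_contains_cball by blast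
    have "uniform_limit (cball s d) (\<lambda>N s. \<Sum>n<N. em_defect c \<Psi> n s) R sequentially"
      unfolding R_def
    proof (rule Weierstrass_m_test)
      fix n t assume t: "t \<in> cball s d"
      then have "norm t \<le> norm s + d"
        using norm_triangle_ineq2[of t s] by (simp add: dist_norm norm_minus_commute)
      then have "130 * (1 + norm t) * ?b n \<le> 130 * (1 + (norm s + d)) * ?b n"
        by (intro mult_right_mono mult_left_mono) auto
      then show "norm (em_defect c \<Psi> n t) \<le> 130 * (1 + (norm s + d)) * ?b n"
        using order_trans[OF bnd[of t n]] t d by blast
    qed (rule summable_mult[OF sb])
    then show "\<exists>d>0. cball s d \<subseteq> D \<and> uniform_limit (cball s d) (\<lambda>N s. \<Sum>n<N. em_defect c \<Psi> n s) R sequentially"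
      using d by blast
  qed
  moreover have "eventually (\<lambda>s. norm (R s) \<le> 130 * (1 + 2) * (\<Sum>n. ?b n)) (at 1)"
    unfolding eventually_at
  proof (intro exI[of _ "1/2"] conjI ballI impI)
    fix s :: complex assume s: "s \<noteq> 1 \<and> dist s 1 < 1 / 2"
    have "\<bar>Re (s - 1)\<bar> \<le> norm (s - 1)" by (rule abs_Re_le_cmod)
    then have "s \<in> D" using s unfolding D by (auto simp: dist_norm)
    moreover have "norm s \<le> 2" using s norm_triangle_ineq2[of s 1] by (simp add: dist_norm)
    then have "130 * (1 + norm s) * (\<Sum>n. ?b n) \<le> 130 * (1 + 2) * (\<Sum>n. ?b n)"
      using sb by (intro mult_right_mono mult_left_mono suminf_nonneg) auto
    ultimately show "norm (R s) \<le> 130 * (1 + 2) * (\<Sum>n. ?b n)" using Rb[of s] by linarith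
  qed simp
  moreover have "(1::complex) \<in> interior {s. Re s > 1 / 2}"
    unfolding interior_open[OF open_halfspace_Re_gt] by simp
  ultimately obtain R' where R': "R' holomorphic_on {s. Re s > 1 / 2}" "\<forall>s\<in>D. R' s = R s"
    using holomorphic_on_extend_bounded[of R "{s. Re s > 1 / 2}" 1] D by auto
  show thesis
  proof (rule that[OF R'(1)])
    fix s assume "s \<in> D"
    then show "(\<lambda>n. em_defect c \<Psi> n s) sums R' s"
      using R'(2) summ[of s] by (simp add: R_def summable_sums)
  qed
qed

lemma em_defect_partial_sum:
  "(\<Sum>n<N. em_defect c \<Psi> n s) = (\<Sum>n<N. chirp c s (of_real (ln (Suc n))))
     - (\<Psi> (s - 1) (of_real (ln (Suc N))) - \<Psi> (s - 1) 0)"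
  by (induction N) (auto simp: em_defect_def)

lemma summable_norm_chirp:
  assumes "Re c = 0" "Re s > 1"
  shows "summable (\<lambda>n. norm (chirp c s (of_real (ln (Suc n)))))"
proof -
  \<comment> \<open>Half of the room above 1 pays for the logarithm; the other half keeps the
    exponent \<open>- 1 - e\<close> below \<open>- 1\<close>.\<close>
  define e where "e = (Re s - 1) / 2"
  have e: "e > 0" using assms by (simp add: e_def)
  have "summable (\<lambda>n. real n powr (- 1 - e))" using e by (simp add: summable_real_powr_iff)
  then have "summable (\<lambda>n. real (Suc n) powr (- 1 - e))"
    by (subst summable_Suc_iff)
  then have "summable (\<lambda>n. 1 / e * real (Suc n) powr (- 1 - e))" by (rule summable_mult)
  then show ?thesis
  proof (rule summable_comparison_test')
    fix n :: nat
    let ?x = "real (Suc n)"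
    have "norm (chirp c s (of_real (ln ?x))) = ln ?x * exp (- Re s * ln ?x)"
      unfolding chirp_def norm_mult norm_exp_chirp[OF assms(1)] by simp
    also have "\<dots> \<le> ?x powr e / e * exp (- Re s * ln ?x)"
      using ln_powr_bound[of ?x e] e by (intro mult_right_mono) auto
    also have "exp (- Re s * ln ?x) = ?x powr (- Re s)"
      by (simp add: powr_def)
    also have "?x powr e / e * ?x powr (- Re s) = 1 / e * ?x powr (e - Re s)"
      by (simp add: powr_diff powr_minus_divide)
    also have "e - Re s = - 1 - e" by (simp add: e_def field_simps)
    finally show "norm (norm (chirp c s (of_real (ln ?x)))) \<le> 1 / e * ?x powr (- 1 - e)" by simp
  qed
qed

section \<open>Analytic continuation of the chirp series\<close>

lemma ln_Suc_at_top: "filterlim (\<lambda>N. ln (real (Suc N))) at_top sequentially"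
  by real_asymp

text \<open>This reduces continuation of the series to continuation of
  \<open>L - \<Psi> (s - 1) 0\<close>, as the defect sum is already holomorphic further left. The
  lower end is 0 because \<open>ln 1 = 0\<close>.\<close>

lemma em_limit:
  assumes "(\<lambda>n. em_defect c \<Psi> n s) sums R"
    and "(\<lambda>N. \<Psi> (s - 1) (of_real (ln (Suc N)))) \<longlonglongrightarrow> L"
  shows "(\<lambda>n. chirp c s (of_real (ln (Suc n)))) sums (R + (L - \<Psi> (s - 1) 0))"
proof -
  have "(\<lambda>N. (\<Sum>n<N. em_defect c \<Psi> n s) + (\<Psi> (s - 1) (of_real (ln (Suc N))) - \<Psi> (s - 1) 0))
     \<longlonglongrightarrow> R + (L - \<Psi> (s - 1) 0)"
    using assms by (intro tendsto_intros) (auto simp: sums_def)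
  then show ?thesis by (simp add: em_defect_partial_sum sums_def)
qed

text \<open>The comparison read backwards: absolute convergence of the series forces the primitive
  to have a limit, without evaluating any integral.\<close>

lemma em_primitive_convergent:
  assumes "(\<lambda>n. em_defect c \<Psi> n s) sums R" "Re c = 0" "Re s > 1"
  shows "convergent (\<lambda>N. \<Psi> (s - 1) (of_real (ln (Suc N))))"
proof -
  have "summable (\<lambda>n. chirp c s (of_real (ln (Suc n))))"
    using assms by (intro summable_norm_cancel[OF summable_norm_chirp])
  then have "(\<lambda>N. (\<Sum>n<N. chirp c s (of_real (ln (Suc n)))) - (\<Sum>n<N. em_defect c \<Psi> n s) + \<Psi> (s - 1) 0)
      \<longlonglongrightarrow> (\<Sum>n. chirp c s (of_real (ln (Suc n)))) - R + \<Psi> (s - 1) 0"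
    using assms(1) by (intro tendsto_intros) (auto simp: summable_LIMSEQ sums_def)
  then show ?thesis by (auto simp: em_defect_partial_sum convergent_def)
qed

section \<open>Decay at infinity and the series for \<open>c = 0\<close>\<close>

lemma exp_chirp_tendsto_0:
  assumes "Re c = 0" "Re z > 0"
  shows "((\<lambda>u::real. exp (c * (of_real u)\<^sup>2 - z * of_real u)) \<longlongrightarrow> 0) at_top"
proof -
  have "((\<lambda>u. exp (- Re z * u)) \<longlongrightarrow> 0) at_top" using assms(2) by real_asymp
  then show ?thesis
    by (rule Lim_null_comparison[rotated]) (simp add: norm_exp_chirp[OF assms(1)] del: norm_exp_eq_Re)
qed

lemma chirp_tendsto_0:
  assumes "Re c = 0" "Re z > 0"
  shows "((\<lambda>u::real. chirp c z (of_real u)) \<longlongrightarrow> 0) at_top"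
proof -
  have "((\<lambda>u. \<bar>u\<bar> * exp (- Re z * u)) \<longlongrightarrow> 0) at_top" using assms(2) by real_asymp
  then show ?thesis
    by (rule Lim_null_comparison[rotated])
       (simp add: chirp_def norm_mult norm_exp_chirp[OF assms(1)] del: norm_exp_eq_Re)
qed

lemma chirp_series_0:
  obtains R where "R holomorphic_on {s. Re s > 1 / 2}"
    "\<And>s. Re s > 1 \<Longrightarrow> (\<lambda>n. chirp 0 s (of_real (ln (Suc n)))) sums (1 / (s - 1)\<^sup>2 + R s)"
proof -
  \<comment> \<open>The primitive that vanishes at infinity for \<open>Re z > 0\<close>; its value
    at \<open>u = 0\<close> contributes the double pole.\<close>
  define \<Psi> :: "complex \<Rightarrow> complex \<Rightarrow> complex" where "\<Psi> z u = - (u / z + 1 / z\<^sup>2) * exp (- z * u)" for z u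
  define D where "D = {s. Re s > 1 / 2} - {1}"
  have d1: "(\<Psi> (s - 1) has_field_derivative chirp 0 (s - 1) u) (at u)" if "s \<in> D" for s u
  proof -
    have "s - 1 \<noteq> 0" using that by (auto simp: D_def)
    then show ?thesis unfolding \<Psi>_def chirp_def
      by (auto intro!: derivative_eq_intros simp: divide_simps) (auto simp: algebra_simps power2_eq_square)
  qed
  have d2: "(\<lambda>s. \<Psi> (s - 1) u) holomorphic_on D" for u
    unfolding \<Psi>_def D_def by (intro holomorphic_intros) auto
  obtain R where R: "R holomorphic_on {s. Re s > 1 / 2}"
      "\<And>s. s \<in> D \<Longrightarrow> (\<lambda>n. em_defect 0 \<Psi> n s) sums R s"
    by (rule em_series[OF _ _ d1 d2 D_def]) (simp, simp, blast+)
  show thesis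
  proof (rule that[OF R(1)])
    fix s assume s: "Re s > 1"
    let ?z = "s - 1"
    have z: "Re ?z > 0" using s by simp
    have "((\<lambda>u. - (chirp 0 ?z (of_real u) / ?z + exp (0 * (of_real u)\<^sup>2 - ?z * of_real u) / ?z\<^sup>2)) \<longlongrightarrow> - (0 / ?z + 0 / ?z\<^sup>2)) at_top"
      using z by (intro tendsto_intros chirp_tendsto_0 exp_chirp_tendsto_0) auto
    then have "((\<lambda>u. \<Psi> ?z (of_real u)) \<longlongrightarrow> 0) at_top"
      by (simp add: \<Psi>_def chirp_def algebra_simps)
    from filterlim_compose[OF this ln_Suc_at_top]
    have "(\<lambda>n. chirp 0 s (of_real (ln (Suc n)))) sums (R s + (0 - \<Psi> ?z 0))"
      using s by (intro em_limit R(2)) (auto simp: D_def)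
    then show "(\<lambda>n. chirp 0 s (of_real (ln (Suc n)))) sums (1 / (s - 1)\<^sup>2 + R s)"
      by (simp add: \<Psi>_def add.commute)
  qed
qed

text \<open>Regard \<open>E (u + c * \<zeta> / 2)\<close> as a function of \<open>\<zeta>\<close>.
  On the segment from 1 to \<open>z\<close>, which stays in the right half-plane, its derivative
  decays exponentially in \<open>u\<close>.\<close>

lemma chirp_primitive_limit_unique:
  assumes c: "c = \<i> \<or> c = - \<i>" and z: "Re z > 0"
    and E: "\<And>w. (E has_field_derivative exp (c * w\<^sup>2)) (at w)"
  shows "((\<lambda>u::real. E (of_real u + c * z / 2) - E (of_real u + c / 2)) \<longlongrightarrow> 0) at_top"
proof -
  have cc: "c * c = - 1" "Re c = 0" "norm c = 1" using c by auto
  \<comment> \<open>\<open>m\<close> bounds \<open>Re \<zeta>\<close> from below on the segment;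
    \<open>K\<close> bounds the factor free of \<open>u\<close>, as
    \<open>norm \<zeta> \<le> 1 + norm z\<close> there.\<close>
  define m where "m = min 1 (Re z)"
  define K where "K = exp ((1 + norm z)\<^sup>2 / 4)"
  have bound: "norm (E (of_real u + c * z / 2) - E (of_real u + c / 2)) \<le> exp (- m * u) * K / 2 * norm (z - 1)"
    if u: "u \<ge> 0" for u :: real
  proof -
    have "norm ((\<lambda>\<zeta>. E (of_real u + c * \<zeta> / 2)) z - (\<lambda>\<zeta>. E (of_real u + c * \<zeta> / 2)) 1)
        \<le> exp (- m * u) * K / 2 * norm (z - 1)"
    proof (rule field_differentiable_bound[of "closed_segment 1 z"])
      fix \<zeta> assume \<zeta>: "\<zeta> \<in> closed_segment 1 z"
      show "((\<lambda>\<zeta>. E (of_real u + c * \<zeta> / 2)) has_field_derivative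
          exp (c * (of_real u + c * \<zeta> / 2)\<^sup>2) * (c / 2)) (at \<zeta> within closed_segment 1 z)"
        by (rule DERIV_chain2[OF E]) (auto intro!: derivative_eq_intros)
      \<comment> \<open>Since \<open>c * c = - 1\<close>, the cross term becomes
        \<open>- \<zeta> * u\<close>, the source of the decay.\<close>
      have "c * (of_real u + c * \<zeta> / 2)\<^sup>2
          = c * (of_real u)\<^sup>2 + (c * c) * \<zeta> * of_real u + (c * c) * c * \<zeta>\<^sup>2 / 4"
        by (simp add: power2_eq_square algebra_simps)
      also have "\<dots> = (c * (of_real u)\<^sup>2 - \<zeta> * of_real u) + - (c * \<zeta>\<^sup>2 / 4)"
        unfolding cc(1) by simp
      finally have "norm (exp (c * (of_real u + c * \<zeta> / 2)\<^sup>2))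
          = exp (- Re \<zeta> * u) * norm (exp (- (c * \<zeta>\<^sup>2 / 4)))"
        using norm_exp_chirp[OF cc(2)] by (simp only: exp_add norm_mult)
      also have "\<dots> \<le> exp (- m * u) * K"
      proof (intro mult_mono)
        obtain t where t: "0 \<le> t" "t \<le> 1" "\<zeta> = (1 - t) *\<^sub>R 1 + t *\<^sub>R z"
          using \<zeta> unfolding closed_segment_def by blast
        have "Re \<zeta> = (1 - t) * 1 + t * Re z" unfolding t(3) by simp
        moreover have "(1 - t) * m + t * m \<le> (1 - t) * 1 + t * Re z"
          using t by (intro add_mono mult_left_mono) (auto simp: m_def)
        ultimately have "m \<le> Re \<zeta>" by (simp add: algebra_simps)
        then show "exp (- Re \<zeta> * u) \<le> exp (- m * u)" using u by (simp add: mult_right_mono)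
        have "norm \<zeta> \<le> norm ((1 - t) *\<^sub>R (1::complex)) + norm (t *\<^sub>R z)"
          unfolding t(3) by (rule norm_triangle_ineq)
        also have "\<dots> \<le> 1 * norm (1::complex) + 1 * norm z"
          unfolding norm_scaleR using t by (intro add_mono mult_right_mono) auto
        finally have "(norm \<zeta>)\<^sup>2 \<le> (1 + norm z)\<^sup>2" by (intro power_mono) auto
        then have "norm (- (c * \<zeta>\<^sup>2 / 4)) \<le> (1 + norm z)\<^sup>2 / 4"
          using cc by (simp add: norm_mult norm_divide norm_power)
        then show "norm (exp (- (c * \<zeta>\<^sup>2 / 4))) \<le> K"
          unfolding K_def by (intro order_trans[OF norm_exp]) simp
      qed auto
      finally show "norm (exp (c * (of_real u + c * \<zeta> / 2)\<^sup>2) * (c / 2)) \<le> exp (- m * u) * K / 2"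
        unfolding norm_mult using cc by (simp add: norm_divide)
    qed auto
    then show ?thesis by simp
  qed
  have "m > 0" using z by (simp add: m_def)
  then have "((\<lambda>u. exp (- m * u) * K / 2 * norm (z - 1)) \<longlongrightarrow> 0) at_top"
    by real_asymp
  then show ?thesis
    by (rule Lim_null_comparison[rotated]) (rule eventually_mono[OF eventually_ge_at_top[of 0] bound])
qed

text \<open>No pole arises: the boundary value at infinity involves \<open>z\<close> only through
  entire functions and a constant \<open>C\<close>.\<close>

lemma chirp_series_imaginary:
  assumes c: "c = \<i> \<or> c = - \<i>"
  obtains R where "R holomorphic_on {s. Re s > 1 / 2}"
    "\<And>s. Re s > 1 \<Longrightarrow> (\<lambda>n. chirp c s (of_real (ln (Suc n)))) sums R s"
proof -
  have cc: "c * c = - 1" "Re c = 0" "norm c = 1" "c \<noteq> 0" using c by auto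
  obtain E where "\<And>w. w \<in> UNIV \<Longrightarrow> (E has_field_derivative exp (c * w\<^sup>2)) (at w within UNIV)"
    by (rule holomorphic_convex_primitive'[of UNIV "\<lambda>w. exp (c * w\<^sup>2)"]) (auto intro!: holomorphic_intros)
  then have E: "(E has_field_derivative exp (c * w\<^sup>2)) (at w)" for w by simp
  have E_hol: "E holomorphic_on UNIV"
    using E by (auto simp: holomorphic_on_def field_differentiable_def)
  have E_comp: "(\<lambda>s. E (h s)) holomorphic_on A" if "h holomorphic_on A" for h A
    using holomorphic_on_compose_gen[OF that E_hol] by (simp add: o_def)
  \<comment> \<open>Completing the square: \<open>c u\<^sup>2 - z u = c (u + c z / 2)\<^sup>2 + c z\<^sup>2 / 4\<close>, as \<open>c\<^sup>2 = -1\<close>.\<close>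
  define \<Psi> where "\<Psi> z u = exp (c * u\<^sup>2 - z * u) / (2 * c)
     + z / (2 * c) * exp (c * z\<^sup>2 / 4) * (E (u + c * z / 2) - E (c * z / 2))" for z u
  define D where "D = {s. Re s > 1 / 2} - {1}"
  have d1: "(\<Psi> z has_field_derivative chirp c z u) (at u)" for z u
  proof -
    have "((\<lambda>u. E (u + c * z / 2)) has_field_derivative exp (c * (u + c * z / 2)\<^sup>2) * 1) (at u)"
      by (rule DERIV_chain2[OF E]) (auto intro!: derivative_eq_intros)
    then have "(\<Psi> z has_field_derivative exp (c * u\<^sup>2 - z * u) * (2 * c * u - z) / (2 * c)
        + z / (2 * c) * exp (c * z\<^sup>2 / 4) * (exp (c * (u + c * z / 2)\<^sup>2) * 1 - 0)) (at u)"
      unfolding \<Psi>_def using cc(4) by (auto intro!: derivative_eq_intros simp: field_simps power2_eq_square)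
    moreover have "exp (c * z\<^sup>2 / 4) * exp (c * (u + c * z / 2)\<^sup>2) = exp (c * u\<^sup>2 - z * u)"
    proof -
      have "c * z\<^sup>2 / 4 + c * (u + c * z / 2)\<^sup>2
          = c * z\<^sup>2 / 4 + c * u\<^sup>2 + (c * c) * z * u + (c * c) * c * z\<^sup>2 / 4"
        by (simp add: power2_eq_square algebra_simps)
      also have "\<dots> = c * u\<^sup>2 - z * u" unfolding cc(1) by simp
      finally show ?thesis by (simp flip: exp_add)
    qed
    then have "exp (c * u\<^sup>2 - z * u) * (2 * c * u - z) / (2 * c)
        + z / (2 * c) * exp (c * z\<^sup>2 / 4) * (exp (c * (u + c * z / 2)\<^sup>2) * 1 - 0) = chirp c z u"
      using cc(4) by (simp add: mult.assoc) (simp add: chirp_def field_simps)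
    ultimately show ?thesis by simp
  qed
  have d2: "(\<lambda>s. \<Psi> (s - 1) u) holomorphic_on D" for u
    unfolding \<Psi>_def using cc(4) by (intro holomorphic_intros E_comp) auto
  obtain R where R: "R holomorphic_on {s. Re s > 1 / 2}"
      "\<And>s. s \<in> D \<Longrightarrow> (\<lambda>n. em_defect c \<Psi> n s) sums R s"
    by (rule em_series[OF cc(2) _ d1 d2 D_def]) (simp add: cc, blast)
  let ?u = "\<lambda>N. complex_of_real (ln (Suc N))"
  have exp0: "(\<lambda>N. exp (c * (?u N)\<^sup>2 - z * ?u N)) \<longlonglongrightarrow> 0" if "Re z > 0" for z
    using filterlim_compose[OF exp_chirp_tendsto_0[OF cc(2) that] ln_Suc_at_top] .
  \<comment> \<open>Convergence at the single point \<open>s = 2\<close> suffices: solving the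
    definition of \<open>\<Psi>\<close> at \<open>z = 1\<close> for \<open>E\<close> yields
    \<open>C\<close>, and \<open>chirp_primitive_limit_unique\<close> carries it to every
    \<open>z\<close> with positive real part.\<close>
  have "convergent (\<lambda>N. \<Psi> (2 - 1) (?u N))"
    by (rule em_primitive_convergent[OF R(2) cc(2)]) (auto simp: D_def)
  then obtain l where "(\<lambda>N. \<Psi> 1 (?u N)) \<longlonglongrightarrow> l" by (auto simp: convergent_def)
  then have "(\<lambda>N. (\<Psi> 1 (?u N) - exp (c * (?u N)\<^sup>2 - 1 * ?u N) / (2 * c)) * (2 * c) * exp (- c / 4) + E (c / 2))
      \<longlonglongrightarrow> (l - 0 / (2 * c)) * (2 * c) * exp (- c / 4) + E (c / 2)"
    using cc(4) by (intro tendsto_intros exp0) auto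
  moreover have "(\<Psi> 1 u - exp (c * u\<^sup>2 - 1 * u) / (2 * c)) * (2 * c) * exp (- c / 4) + E (c / 2) = E (u + c / 2)" for u
    using cc(4) by (simp add: \<Psi>_def exp_minus field_simps)
  ultimately obtain C where C: "(\<lambda>N. E (?u N + c / 2)) \<longlonglongrightarrow> C" by auto
  have Cz: "(\<lambda>N. E (?u N + c * z / 2)) \<longlonglongrightarrow> C" if "Re z > 0" for z
    using tendsto_add[OF C filterlim_compose[OF chirp_primitive_limit_unique[OF c that E] ln_Suc_at_top]]
    by simp
  define L where "L z = z / (2 * c) * exp (c * z\<^sup>2 / 4) * (C - E (c * z / 2))" for z
  show thesis
  \<comment> \<open>The subtracted \<open>1 / (2 * c)\<close> is \<open>\<Psi> (s - 1) 0\<close>,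
    where the two values of \<open>E\<close> cancel.\<close>
  proof (rule that[of "\<lambda>s. R s + (L (s - 1) - 1 / (2 * c))"])
    show "(\<lambda>s. R s + (L (s - 1) - 1 / (2 * c))) holomorphic_on {s. Re s > 1 / 2}"
      unfolding L_def using cc(4) by (intro holomorphic_intros R E_comp) auto
    fix s assume s: "Re s > 1"
    have "(\<lambda>N. \<Psi> (s - 1) (?u N)) \<longlonglongrightarrow> 0 / (2 * c) + L (s - 1)"
      unfolding \<Psi>_def L_def using s cc(4) by (intro tendsto_intros exp0 Cz) auto
    then have "(\<lambda>n. chirp c s (?u n)) sums (R s + (0 / (2 * c) + L (s - 1) - \<Psi> (s - 1) 0))"
      using s by (intro em_limit R(2)) (auto simp: D_def)
    then show "(\<lambda>n. chirp c s (?u n)) sums (R s + (L (s - 1) - 1 / (2 * c)))"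
      by (simp add: \<Psi>_def)
  qed
qed

section \<open>The Dirichlet series\<close>

text \<open>Euler's formula for the cosine, with the index shifted so that sums over
  \<open>nat\<close> start at the integer 1.\<close>

lemma dirichlet_term_chirp_coeff:
  "dirichlet_term (\<lambda>n. chirp_coeff (real n)) s (Suc n) =
     chirp 0 s (of_real (ln (Suc n)))
     + (chirp \<i> s (of_real (ln (Suc n))) + chirp (- \<i>) s (of_real (ln (Suc n)))) / 2"
proof -
  define u where "u = complex_of_real (ln (Suc n))"
  have pow: "of_nat (Suc n) powr (- s) = exp (- s * u)"
    using Ln_of_nat[of "Suc n"] by (simp add: powr_def u_def del: of_nat_Suc)
  have coeff: "complex_of_real (chirp_coeff (Suc n)) = u * (1 + cos (u\<^sup>2))"
    by (simp add: chirp_coeff_def u_def cos_of_real flip: of_real_power)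
  have exp: "exp (c * u\<^sup>2 - s * u) = exp (c * u\<^sup>2) * exp (- s * u)" for c
    by (simp flip: exp_add)
  show ?thesis
    unfolding u_def[symmetric] dirichlet_term_def chirp_def pow coeff cos_exp_eq exp
    by (simp add: field_simps)
qed

lemma atLeast_1_eq_range_Suc: "{1..} = range Suc"
  by (auto simp: image_iff) (metis Suc_pred' not_less_eq_eq not_less0 Suc_le_eq)

lemma summable_norm_dirichlet_chirp_coeff:
  assumes "Re s > 1"
  shows "summable (\<lambda>n. norm (dirichlet_term (\<lambda>n. chirp_coeff (real n)) s (Suc n)))"
proof (rule summable_comparison_test')
  let ?n = "\<lambda>c n. norm (chirp c s (of_real (ln (Suc n))))"
  show "summable (\<lambda>n. ?n 0 n + (?n \<i> n + ?n (- \<i>) n))"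
    using assms by (intro summable_add summable_norm_chirp) auto
  fix n
  have "norm ((chirp \<i> s (of_real (ln (Suc n))) + chirp (- \<i>) s (of_real (ln (Suc n)))) / 2) \<le> ?n \<i> n + ?n (- \<i>) n"
    using norm_triangle_ineq[of "chirp \<i> s (of_real (ln (Suc n)))" "chirp (- \<i>) s (of_real (ln (Suc n)))"]
      norm_ge_zero[of "chirp \<i> s (of_real (ln (Suc n)))"] norm_ge_zero[of "chirp (- \<i>) s (of_real (ln (Suc n)))"]
    unfolding norm_divide norm_numeral by linarith
  then show "norm (norm (dirichlet_term (\<lambda>n. chirp_coeff (real n)) s (Suc n))) \<le> ?n 0 n + (?n \<i> n + ?n (- \<i>) n)"
    unfolding dirichlet_term_chirp_coeff real_norm_def abs_norm_cancel
    by (intro order_trans[OF norm_triangle_ineq] add_left_mono)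
qed

text \<open>Bridges the unordered sum in \<open>dirichlet_series\<close> and the ordered sums above;
  absolute summability makes them agree.\<close>

lemma dirichlet_series_eqI:
  assumes "summable (\<lambda>n. norm (dirichlet_term a s (Suc n)))" "(\<lambda>n. dirichlet_term a s (Suc n)) sums S"
  shows "dirichlet_series a s = S"
proof -
  have "dirichlet_series a s = infsum (dirichlet_term a s \<circ> Suc) UNIV"
    unfolding dirichlet_series_def atLeast_1_eq_range_Suc by (rule infsum_reindex) simp
  also have "\<dots> = S"
    using norm_summable_imp_has_sum[OF assms] by (intro infsumI) (simp add: o_def)
  finally show ?thesis .
qed

lemma dirichlet_series_chirp_coeff:
  obtains R where "R holomorphic_on {s. Re s > 1 / 2}"
    "\<And>s. Re s > 1 \<Longrightarrow> dirichlet_series (\<lambda>n. chirp_coeff (real n)) s = 1 / (s - 1)\<^sup>2 + R s"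
proof -
  obtain R0 where R0: "R0 holomorphic_on {s. Re s > 1 / 2}"
    "\<And>s. Re s > 1 \<Longrightarrow> (\<lambda>n. chirp 0 s (of_real (ln (Suc n)))) sums (1 / (s - 1)\<^sup>2 + R0 s)"
    using chirp_series_0 by blast
  obtain R1 where R1: "R1 holomorphic_on {s. Re s > 1 / 2}"
    "\<And>s. Re s > 1 \<Longrightarrow> (\<lambda>n. chirp \<i> s (of_real (ln (Suc n)))) sums R1 s"
    by (rule chirp_series_imaginary[of \<i>]) auto
  obtain R2 where R2: "R2 holomorphic_on {s. Re s > 1 / 2}"
    "\<And>s. Re s > 1 \<Longrightarrow> (\<lambda>n. chirp (- \<i>) s (of_real (ln (Suc n)))) sums R2 s"
    by (rule chirp_series_imaginary[of "- \<i>"]) auto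
  show thesis
  proof (rule that[of "\<lambda>s. R0 s + (R1 s + R2 s) / 2"])
    show "(\<lambda>s. R0 s + (R1 s + R2 s) / 2) holomorphic_on {s. Re s > 1 / 2}"
      by (intro holomorphic_intros R0 R1 R2) auto
    fix s assume s: "Re s > 1"
    have "(\<lambda>n. dirichlet_term (\<lambda>n. chirp_coeff (real n)) s (Suc n))
        sums ((1 / (s - 1)\<^sup>2 + R0 s) + (R1 s + R2 s) / 2)"
      unfolding dirichlet_term_chirp_coeff using s by (intro sums_add sums_divide R0 R1 R2)
    then show "dirichlet_series (\<lambda>n. chirp_coeff (real n)) s = 1 / (s - 1)\<^sup>2 + (R0 s + (R1 s + R2 s) / 2)"
      using dirichlet_series_eqI[OF summable_norm_dirichlet_chirp_coeff[OF s]] by (simp add: add.assoc)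
  qed
qed

section \<open>The double pole at 1\<close>

lemma double_pole_extension:
  assumes R: "R holomorphic_on {s. Re s > 1 / 2}"
    and A: "\<And>s. Re s > 1 \<Longrightarrow> A s = 1 / (s - 1)\<^sup>2 + R s"
  shows "extends_to_closed_halfplane_with_pole A 2"
proof -
  let ?U = "{s. Re s > 1 / 2}"
  define g where "g s = 1 / (s - 1)\<^sup>2 + R s" for s
  \<comment> \<open>The numerator over \<open>(s - 1)\<^sup>2\<close>; as \<open>h 1 = 1\<close> is
    nonzero, the order of the pole is exactly 2.\<close>
  define h where "h s = 1 + (s - 1)\<^sup>2 * R s" for s
  have U: "open ?U" "(1::complex) \<in> ?U" using open_halfspace_Re_gt[of "1/2"] by auto
  have h: "h holomorphic_on ?U" unfolding h_def by (intro holomorphic_intros R)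
  have gh: "g s = h s / (s - 1) ^ 2" if "s \<noteq> 1" for s
    using that by (simp add: g_def h_def field_simps)
  have "is_pole (\<lambda>s. h s / (s - 1) ^ 2) 1"
    by (rule is_pole_basic[OF h U]) (simp_all add: h_def)
  moreover have "eventually (\<lambda>s. h s / (s - 1) ^ 2 = g s) (at 1)"
    using gh by (auto simp: eventually_at_filter)
  ultimately have "is_pole g 1" by (rule is_pole_transform) simp
  moreover have "zorder g 1 = - int 2"
  proof (rule zorder_eqI[OF U h])
    show "g s = h s * (s - 1) powi (- int 2)" if "s \<noteq> 1" for s
      unfolding gh[OF that] power_int_minus power_int_of_nat by (simp add: divide_inverse)
  qed (simp add: h_def)
  moreover have "g holomorphic_on (?U - {1})"
    unfolding g_def by (intro holomorphic_intros holomorphic_on_subset[OF R]) auto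
  ultimately show ?thesis
    unfolding extends_to_closed_halfplane_with_pole_def
    using U A by (intro exI[of _ ?U] exI[of _ g]) (auto simp: g_def)
qed

theorem theoremA4:
  shows "\<exists>a :: nat \<Rightarrow> real.
      (\<forall>n\<ge>1. a n = ln (real n) * (1 + cos ((ln (real n))\<^sup>2))) \<and>
      (\<forall>n\<ge>1. a n \<ge> 0) \<and>
      (\<forall>s. Re s > 1 \<longrightarrow> (\<lambda>n. norm (dirichlet_term a s n)) summable_on {1..}) \<and>
      extends_to_closed_halfplane_with_pole (dirichlet_series a) 2 \<and>
      (\<lambda>x. summatory a x - (x * ln x + x * (1 / 2 * sin ((ln x)\<^sup>2) - 1)))
        \<in> O[at_top](\<lambda>x. x / ln x) \<and>
      \<not> (\<exists>c\<^sub>1 c\<^sub>0 :: real.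
            (\<lambda>x. summatory a x - x * (c\<^sub>1 * ln x + c\<^sub>0)) \<in> o[at_top](\<lambda>x. x))"
proof (intro exI[of _ "\<lambda>n. chirp_coeff (real n)"] conjI allI impI)
  let ?a = "\<lambda>n. chirp_coeff (real n)"
  show "?a n = ln (real n) * (1 + cos ((ln (real n))\<^sup>2))" for n
    by (simp add: chirp_coeff_def)
  show "?a n \<ge> 0" if "n \<ge> 1" for n
  proof -
    have "1 + cos ((ln (real n))\<^sup>2) \<ge> 0" using cos_ge_minus_one[of "(ln (real n))\<^sup>2"] by linarith
    then show ?thesis using that by (simp add: chirp_coeff_def)
  qed
  show "(\<lambda>n. norm (dirichlet_term ?a s n)) summable_on {1..}" if "Re s > 1" for s
    unfolding atLeast_1_eq_range_Suc
    \<comment> \<open>For nonnegative real terms, unordered summability over \<open>UNIV\<close> is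
      ordinary summability.\<close>
    by (subst summable_on_reindex)
       (use summable_norm_dirichlet_chirp_coeff[OF that] in \<open>auto simp: o_def summable_on_UNIV_nonneg_real_iff\<close>)
  show "extends_to_closed_halfplane_with_pole (dirichlet_series ?a) 2"
    using dirichlet_series_chirp_coeff double_pole_extension by metis
  show "(\<lambda>x. summatory ?a x - (x * ln x + x * (1 / 2 * sin ((ln x)\<^sup>2) - 1))) \<in> O(\<lambda>x. x / ln x)"
    by (rule summatory_chirp_coeff)
  then show "\<not> (\<exists>c\<^sub>1 c\<^sub>0. (\<lambda>x. summatory ?a x - x * (c\<^sub>1 * ln x + c\<^sub>0)) \<in> o(\<lambda>x. x))"
    using no_linear_main_term by blast
qed

end
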